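(* Let $\mathcal{P}$ be a family of finite posets with $h(\mathcal{P})\ge 2$. Let $Q\in\mathcal{P}$ have height $h(Q)=h(\mathcal{P})$ and width $w(Q)=w(\mathcal{P})$. For every $\varepsilon>0$ and every finite poset $P$, if $t(Q,P)<\left(\frac{\varepsilon}{2}\right)^{h(\mathcal{P})\,w(\mathcal{P})^2}$, then there exists a $\mathcal{P}$-free (moreover, $C_{h(\mathcal{P})}$-free) subposet of $P$ obtained by the removal of at most $\varepsilon|P|^2$ edges.
   Context: A poset is a set with an anti-reflexive, transitive relation $\prec$; it is regarded as a digraph whose edges are the pairs $(x,y)$ with $x\prec y$. $|P|$ is the number of elements of $P$. The height $h(P)$ is the number of elements of a longest chain of $P$, and the width $w(P)$ is the size of a largest antichain of $P$. For a (possibly infinite) family $\mathcal{P}$ of finite posets, $h(\mathcal{P})=\min_{P\in\mathcal{P}}h(P)$ and $w(\mathcal{P})=\min\{w(P): P\in\mathcal{P},\ h(P)=h(\mathcal{P})\}$. $C_h$ is the chain with $h$ elements. A map $f:Q\to P$ is a homomorphism if $f(x)\prec f(y)$ whenever $x\prec y$. $t(Q,P)$ is the probability that a uniformly random mapping from $Q$ to $P$ is a homomorphism. Subposets are not necessarily induced: a subposet of $P$ obtained by the removal of edges is a poset on the same set of elements whose edge set is obtained from that of $P$ by deleting those edges. $P$ is $Q$-free if it does not contain $Q$ as a (not necessarily induced) subposet, i.e. there is no injective homomorphism $Q\to P$; $P$ is $\mathcal{P}$-free if it is $Q$-free for every $Q\in\mathcal{P}$. *)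

theory Defs
  imports "HOL-Analysis.Analysis"
begin

record 'a poset =
  elements :: "'a set"
  edges :: "('a \<times> 'a) set"

text \<open>The edges are the pairs \<open>(x, y)\<close> with \<open>x \<prec> y\<close>, for the strict order \<open>\<prec>\<close>.\<close>

definition finite_poset :: "'a poset \<Rightarrow> bool" where
  "finite_poset P \<longleftrightarrow>
     finite (elements P) \<and> edges P \<subseteq> elements P \<times> elements P \<and> irrefl (edges P) \<and> trans (edges P)"

definition chain_in :: "'a poset \<Rightarrow> 'a set \<Rightarrow> bool" where
  "chain_in P C \<longleftrightarrow> C \<subseteq> elements P \<and> total_on C (edges P)"

definition antichain_in :: "'a poset \<Rightarrow> 'a set \<Rightarrow> bool" where
  "antichain_in P A \<longleftrightarrow> A \<subseteq> elements P \<and> (\<forall>x\<in>A. \<forall>y\<in>A. (x, y) \<notin> edges P)"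

definition height :: "'a poset \<Rightarrow> nat" where
  "height P = Max (card ` {C. chain_in P C})"

definition width :: "'a poset \<Rightarrow> nat" where
  "width P = Max (card ` {A. antichain_in P A})"

text \<open>For families, \<open>Inf\<close> on \<^typ>\<open>nat\<close> is the minimum whenever the set is nonempty.\<close>

definition family_height :: "'a poset set \<Rightarrow> nat" where
  "family_height \<P> = Inf (height ` \<P>)"

definition family_width :: "'a poset set \<Rightarrow> nat" where
  "family_width \<P> = Inf (width ` {P \<in> \<P>. height P = family_height \<P>})"

definition chain_poset :: "nat \<Rightarrow> nat poset" where
  "chain_poset h = \<lparr>elements = {..<h}, edges = {(i, j). i < j \<and> j < h}\<rparr>"

text \<open>Homomorphisms are taken in the extensional function space, so that each map between the
  carriers is represented exactly once.\<close>

definition homs :: "'a poset \<Rightarrow> 'b poset \<Rightarrow> ('a \<Rightarrow> 'b) set" where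
  "homs Q P =
     {f \<in> elements Q \<rightarrow>\<^sub>E elements P. \<forall>x y. (x, y) \<in> edges Q \<longrightarrow> (f x, f y) \<in> edges P}"

text \<open>If \<open>P\<close> is empty and \<open>Q\<close> is not, there are no maps at all, and the value is \<open>0\<close>.\<close>

definition hom_density :: "'a poset \<Rightarrow> 'b poset \<Rightarrow> real" where
  "hom_density Q P = measure (uniform_count_measure (elements Q \<rightarrow>\<^sub>E elements P)) (homs Q P)"

definition poset_free :: "'a poset \<Rightarrow> 'b poset \<Rightarrow> bool" where
  "poset_free Q P \<longleftrightarrow> \<not> (\<exists>f \<in> homs Q P. inj_on f (elements Q))"

definition family_free :: "'a poset set \<Rightarrow> 'b poset \<Rightarrow> bool" where
  "family_free \<P> P \<longleftrightarrow> (\<forall>Q \<in> \<P>. poset_free Q P)"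

text \<open>The result of an edge removal has to be a poset again, that is, remain transitive.\<close>

definition edge_removal_subposet :: "'a poset \<Rightarrow> 'a poset \<Rightarrow> bool" where
  "edge_removal_subposet R P \<longleftrightarrow>
     finite_poset R \<and> elements R = elements P \<and> edges R \<subseteq> edges P"

end

theory Submission
  imports Defs
begin

text \<open>
  Put \<open>\<delta> = \<epsilon> / 2\<close>, \<open>n = |P|\<close>, and let \<open>h\<close> and \<open>w\<close> be the height and the width of \<open>Q\<close>.  Define a
  decreasing sequence of sets \<open>L\<^sub>0, L\<^sub>1, \<dots>\<close>: \<open>L\<^sub>0\<close> is all of \<open>P\<close>, and \<open>L\<^sub>i\<^sub>+\<^sub>1\<close> consists of the elements
  that have at least \<open>\<delta> n\<close> elements of \<open>L\<^sub>i\<close> below them (\<open>rich\<close>).  By transitivity every \<open>L\<^sub>i\<close> is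
  an up-set, so the number of sets \<open>L\<^sub>i\<close> with \<open>0 < i < h\<close> that contain a given element is a weakly
  monotone level.

  If \<open>L\<^sub>h\<^sub>-\<^sub>1\<close> has at most \<open>\<delta> n\<close> elements, remove all edges into \<open>L\<^sub>h\<^sub>-\<^sub>1\<close> and all edges between
  elements of equal level.  Either kind accounts for at most \<open>\<delta> n\<^sup>2\<close> edges, and what remains is
  transitive and has only \<open>h - 1\<close> levels available for its chains.  So it contains no chain of
  \<open>h\<close> elements, hence no member of the family either (\<open>sparse_top_imp_removal\<close>).

  If \<open>L\<^sub>h\<^sub>-\<^sub>1\<close> has more than \<open>\<delta> n\<close> elements, walking down the sets \<open>L\<^sub>i\<close> yields at least \<open>(\<delta> n)\<^sup>h\<close>
  chains of \<open>h\<close> elements (\<open>card_walks_ge\<close>).  It remains to pass from chains to copies of \<open>Q\<close>.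
  Assigning to each element of \<open>Q\<close> its rank, and within a rank an index below \<open>w\<close>, embeds \<open>Q\<close>
  into the blow-up of the chain in which each of the \<open>h\<close> elements is replaced by \<open>w\<close> incomparable
  copies (\<open>poset_embeds_in_grid\<close>).  In a transitive target, only consecutive layers of the blow-up
  impose conditions.  Cutting a chain into its even and its odd positions thus turns the chains into
  the edges of a bipartite graph, and the homomorphisms of the blow-up into the pairs of \<open>w\<close>-tuples
  of vertices spanning a complete bipartite graph in it.  Two applications of Jensen's inequality
  (\<open>biclique_density\<close>) bound the density of the latter from below by the edge density to the power
  \<open>w\<^sup>2\<close>, which is at least \<open>\<delta>\<^bsup>h w\<^sup>2\<^esup>\<close>.  This contradicts the hypothesis on \<open>Q\<close>.
\<close>

section \<open>Counting complete bipartite subgraphs\<close>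

lemma power_of_mean_le_mean_of_powers:
  fixes x :: "'a \<Rightarrow> real"
  assumes "finite S" "S \<noteq> {}" "\<And>i. i \<in> S \<Longrightarrow> 0 \<le> x i"
  shows "((\<Sum>i\<in>S. x i) / card S) ^ m \<le> (\<Sum>i\<in>S. x i ^ m) / card S"
proof -
  have "convex_on {0..} (\<lambda>x::real. x ^ m)"
    by (cases "even m")
      (auto intro: convex_power_odd convex_on_subset[OF convex_power_even])
  then have "(\<Sum>i\<in>S. (1 / real (card S)) *\<^sub>R x i) ^ m \<le> (\<Sum>i\<in>S. (1 / real (card S)) * x i ^ m)"
    using assms by (intro convex_on_sum[where C = "{0..}" and f = "\<lambda>x. x ^ m"]) auto
  then show ?thesis
    by (simp add: sum_divide_distrib)
qed

text \<open>
  Sidorenko's inequality for a complete bipartite graph.  The first use of Jensen's inequality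
  averages the powers of the degrees over \<open>B\<close> and bounds the number of \<open>I\<close>-tuples in \<open>A\<close> together with a
  common neighbour; the second averages the powers of the numbers of common neighbours over these
  tuples.
\<close>

lemma biclique_density:
  fixes E :: "('a \<times> 'b) set"
  assumes fin: "finite A" "finite B" "finite I" "finite J" and ne: "A \<noteq> {}" "B \<noteq> {}"
    and E: "E \<subseteq> A \<times> B"
  shows "(card E / (real (card A) * real (card B))) ^ (card I * card J)
    \<le> card {(\<alpha>, \<beta>). \<alpha> \<in> I \<rightarrow>\<^sub>E A \<and> \<beta> \<in> J \<rightarrow>\<^sub>E B \<and> (\<forall>i\<in>I. \<forall>j\<in>J. (\<alpha> i, \<beta> j) \<in> E)}
        / (real (card A) ^ card I * real (card B) ^ card J)"
    (is "?p ^ _ \<le> card ?X / _")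
proof -
  define m k where "m = card I" and "k = card J"
  define deg where "deg b = card {a \<in> A. (a, b) \<in> E}" for b
  define N where "N \<alpha> = {b \<in> B. \<forall>i\<in>I. (\<alpha> i, b) \<in> E}" for \<alpha>
  let ?T = "I \<rightarrow>\<^sub>E A"
  have posA: "real (card A) > 0" and posB: "real (card B) > 0"
    using fin ne by (simp_all add: card_gt_0_iff)
  have finT: "finite ?T" and neT: "?T \<noteq> {}" and cardT: "card ?T = card A ^ m"
    using fin ne by (auto simp: finite_PiE PiE_eq_empty_iff card_PiE m_def)
  have cardE: "card E = (\<Sum>b\<in>B. deg b)"
  proof -
    have "E = (\<lambda>(b, a). (a, b)) ` (SIGMA b:B. {a \<in> A. (a, b) \<in> E})"
      using E by force
    also have "card \<dots> = card (SIGMA b:B. {a \<in> A. (a, b) \<in> E})"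
      by (rule card_image) (auto simp: inj_on_def)
    finally show ?thesis
      using fin by (simp add: deg_def)
  qed
  have stars: "(\<Sum>\<alpha>\<in>?T. card (N \<alpha>)) = (\<Sum>b\<in>B. deg b ^ m)"
  proof -
    have "(\<Sum>\<alpha>\<in>?T. card (N \<alpha>)) = card (SIGMA \<alpha>:?T. N \<alpha>)"
      using finT fin by (simp add: N_def)
    also have "(SIGMA \<alpha>:?T. N \<alpha>)
        = (\<lambda>(b, \<alpha>). (\<alpha>, b)) ` (SIGMA b:B. I \<rightarrow>\<^sub>E {a \<in> A. (a, b) \<in> E})"
      by (auto simp: N_def PiE_def Pi_def image_iff)
    also have "card \<dots> = card (SIGMA b:B. I \<rightarrow>\<^sub>E {a \<in> A. (a, b) \<in> E})"
      by (rule card_image) (auto simp: inj_on_def)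
    also have "\<dots> = (\<Sum>b\<in>B. deg b ^ m)"
      using fin by (simp add: finite_PiE card_PiE deg_def m_def)
    finally show ?thesis .
  qed
  have bicliques: "card ?X = (\<Sum>\<alpha>\<in>?T. card (N \<alpha>) ^ k)"
  proof -
    have "?X = (SIGMA \<alpha>:?T. J \<rightarrow>\<^sub>E N \<alpha>)"
      using fin by (auto simp: N_def PiE_def Pi_def)
    then show ?thesis
      using fin finT by (simp add: finite_PiE card_PiE N_def k_def)
  qed
  let ?S = "\<Sum>b\<in>B. real (deg b) ^ m"
  have "(card E / real (card B)) ^ m \<le> ?S / card B"
    using power_of_mean_le_mean_of_powers[OF fin(2) ne(2), of "\<lambda>b. real (deg b)" m]
    by (simp add: cardE)
  then have "(card E / real (card B)) ^ m / real (card A) ^ m \<le> ?S / card B / real (card A) ^ m"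
    using posA by (intro divide_right_mono) auto
  then have "?p ^ m \<le> ?S / real (card A) ^ m / card B"
    by (simp add: power_divide power_mult_distrib mult.commute)
  then have "(?p ^ m) ^ k \<le> (?S / real (card A) ^ m / card B) ^ k"
    by (intro power_mono) auto
  also have "\<dots> = (?S / real (card A) ^ m) ^ k / real (card B) ^ k"
    by (simp add: power_divide power_mult_distrib)
  also have "(?S / real (card A) ^ m) ^ k \<le> card ?X / real (card A) ^ m"
    using power_of_mean_le_mean_of_powers[OF finT neT, of "\<lambda>\<alpha>. real (card (N \<alpha>))" k]
      arg_cong[OF stars, of real]
    by (simp add: bicliques cardT)
  finally show ?thesis
    using posB by (simp add: divide_right_mono power_mult m_def k_def)
qed

section \<open>Walks and their blow-ups\<close>

definition walks :: "('a \<times> 'a) set \<Rightarrow> 'a set \<Rightarrow> nat \<Rightarrow> (nat \<Rightarrow> 'a) set" where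
  "walks r V h = {c \<in> {..<h} \<rightarrow>\<^sub>E V. \<forall>l. Suc l < h \<longrightarrow> (c l, c (Suc l)) \<in> r}"

text \<open>
  For a transitive relation these are the homomorphisms from the blow-up of the chain of \<open>h\<close> elements
  in which every element is replaced by an antichain of \<open>w\<close> copies (\<open>grid_walks_trans\<close>).
\<close>

definition grid_walks :: "('a \<times> 'a) set \<Rightarrow> 'a set \<Rightarrow> nat \<Rightarrow> nat \<Rightarrow> (nat \<times> nat \<Rightarrow> 'a) set" where
  "grid_walks r V h w = {g \<in> {..<h} \<times> {..<w} \<rightarrow>\<^sub>E V.
     \<forall>l k k'. Suc l < h \<longrightarrow> k < w \<longrightarrow> k' < w \<longrightarrow> (g (l, k), g (Suc l, k')) \<in> r}"

lemma finite_walks: "finite V \<Longrightarrow> finite (walks r V h)"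
  by (rule finite_subset[of _ "{..<h} \<rightarrow>\<^sub>E V"]) (auto simp: walks_def intro!: finite_PiE)

text \<open>
  A walk is an edge between its even part and its odd part, and a walk of the blow-up is a complete
  bipartite graph between \<open>w\<close> even parts and \<open>w\<close> odd parts: the condition on two consecutive layers
  always involves one even and one odd layer.
\<close>

lemma grid_walks_density:
  assumes "finite V" "V \<noteq> {}"
  shows "(card (walks r V h) / real (card V) ^ h) ^ (w * w)
    \<le> card (grid_walks r V h w) / real (card V) ^ (h * w)"
proof -
  define Ev Od where "Ev = {l. l < h \<and> even l}" and "Od = {l. l < h \<and> odd l}"
  define A B where "A = Ev \<rightarrow>\<^sub>E V" and "B = Od \<rightarrow>\<^sub>E V"
  define weave :: "(nat \<Rightarrow> 'a) \<Rightarrow> (nat \<Rightarrow> 'a) \<Rightarrow> nat \<Rightarrow> 'a"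
    where "weave a b l = (if even l then a l else b l)" for a b l
  define E where "E = {(a, b). a \<in> A \<and> b \<in> B \<and>
    (\<forall>l. Suc l < h \<longrightarrow> (weave a b l, weave a b (Suc l)) \<in> r)}"
  let ?W = "{..<w}"
  define X where "X = {(\<alpha>, \<beta>). \<alpha> \<in> ?W \<rightarrow>\<^sub>E A \<and> \<beta> \<in> ?W \<rightarrow>\<^sub>E B \<and>
    (\<forall>i\<in>?W. \<forall>j\<in>?W. (\<alpha> i, \<beta> j) \<in> E)}"
  have finEO: "finite Ev" "finite Od"
    by (simp_all add: Ev_def Od_def)
  have "card Ev + card Od = card (Ev \<union> Od)"
    using finEO by (intro card_Un_disjoint[symmetric]) (auto simp: Ev_def Od_def)
  also have "Ev \<union> Od = {..<h}"
    by (auto simp: Ev_def Od_def)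
  finally have cardEO: "card Ev + card Od = h"
    by simp
  have finAB: "finite A" "finite B" and neAB: "A \<noteq> {}" "B \<noteq> {}"
    using assms finEO by (auto simp: A_def B_def finite_PiE PiE_eq_empty_iff)
  have cardAB: "real (card A) * real (card B) = real (card V) ^ h"
    using finEO by (simp add: A_def B_def card_PiE flip: power_add cardEO)
  have "card (walks r V h) \<le> card E"
  proof (rule card_inj_on_le)
    let ?f = "\<lambda>c. (restrict c Ev, restrict c Od)"
    show "inj_on ?f (walks r V h)"
    proof (rule inj_onI)
      fix c d assume c: "c \<in> walks r V h" "d \<in> walks r V h" and eq: "?f c = ?f d"
      have "c l = d l" if "l < h" for l
      proof (cases "even l")
        case True
        then show ?thesis
          using that fun_cong[of "restrict c Ev" "restrict d Ev" l, OF conjunct1[OF eq[unfolded prod.inject]]]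
          by (simp add: Ev_def)
      next
        case False
        then show ?thesis
          using that fun_cong[of "restrict c Od" "restrict d Od" l, OF conjunct2[OF eq[unfolded prod.inject]]]
          by (simp add: Od_def)
      qed
      then show "c = d"
        using c by (intro PiE_ext[of c "{..<h}" "\<lambda>_. V"]) (auto simp: walks_def)
    qed
    show "?f ` walks r V h \<subseteq> E"
      by (auto simp: walks_def E_def A_def B_def Ev_def Od_def weave_def PiE_def Pi_def)
    show "finite E"
      by (rule finite_subset[of _ "A \<times> B"]) (use finAB in \<open>auto simp: E_def\<close>)
  qed
  then have "(card (walks r V h) / real (card V) ^ h) ^ (w * w)
      \<le> (card E / real (card V) ^ h) ^ (w * w)"
    by (intro power_mono divide_right_mono) auto
  also have "\<dots> \<le> card X / (real (card A) ^ w * real (card B) ^ w)"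
    using biclique_density[OF finAB, of ?W ?W E] neAB
    by (simp add: X_def cardAB E_def subset_iff)
  also have "real (card A) ^ w * real (card B) ^ w = real (card V) ^ (h * w)"
    by (simp add: cardAB power_mult flip: power_mult_distrib)
  also have "card X \<le> card (grid_walks r V h w)"
  proof (rule card_inj_on_le)
    let ?f = "\<lambda>(\<alpha>, \<beta>). \<lambda>p\<in>{..<h} \<times> ?W. weave (\<alpha> (snd p)) (\<beta> (snd p)) (fst p)"
    show "inj_on ?f X"
    proof (rule inj_onI)
      fix p q assume pq: "p \<in> X" "q \<in> X" "?f p = ?f q"
      obtain \<alpha> \<beta> \<alpha>' \<beta>' where p_q: "p = (\<alpha>, \<beta>)" "q = (\<alpha>', \<beta>')"
        by fastforce
      with pq have X: "(\<alpha>, \<beta>) \<in> X" "(\<alpha>', \<beta>') \<in> X" and eq: "?f (\<alpha>, \<beta>) = ?f (\<alpha>', \<beta>')"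
        by simp_all
      have *: "weave (\<alpha> k) (\<beta> k) l = weave (\<alpha>' k) (\<beta>' k) l" if "l < h" "k < w" for l k
        using fun_cong[OF eq, of "(l, k)"] that by simp
      have mem: "\<alpha> \<in> ?W \<rightarrow>\<^sub>E A" "\<alpha>' \<in> ?W \<rightarrow>\<^sub>E A" "\<beta> \<in> ?W \<rightarrow>\<^sub>E B" "\<beta>' \<in> ?W \<rightarrow>\<^sub>E B"
        using X by (simp_all add: X_def)
      have "\<alpha> k = \<alpha>' k" if "k < w" for k
      proof (rule PiE_ext)
        show "\<alpha> k \<in> Ev \<rightarrow>\<^sub>E V" "\<alpha>' k \<in> Ev \<rightarrow>\<^sub>E V"
          using PiE_mem[OF mem(1)] PiE_mem[OF mem(2)] that by (simp_all add: A_def)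
        show "\<alpha> k l = \<alpha>' k l" if "l \<in> Ev" for l
          using *[of l k] \<open>k < w\<close> that by (simp add: Ev_def weave_def)
      qed
      moreover have "\<beta> k = \<beta>' k" if "k < w" for k
      proof (rule PiE_ext)
        show "\<beta> k \<in> Od \<rightarrow>\<^sub>E V" "\<beta>' k \<in> Od \<rightarrow>\<^sub>E V"
          using PiE_mem[OF mem(3)] PiE_mem[OF mem(4)] that by (simp_all add: B_def)
        show "\<beta> k l = \<beta>' k l" if "l \<in> Od" for l
          using *[of l k] \<open>k < w\<close> that by (simp add: Od_def weave_def)
      qed
      ultimately show "p = q"
        using PiE_ext[OF mem(1,2)] PiE_ext[OF mem(3,4)] by (simp add: p_q)
    qed
    show "?f ` X \<subseteq> grid_walks r V h w"
    proof (rule image_subsetI)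
      fix p assume p: "p \<in> X"
      obtain \<alpha> \<beta> where p_eq: "p = (\<alpha>, \<beta>)"
        by fastforce
      with p have X: "(\<alpha>, \<beta>) \<in> X"
        by simp
      have E: "(\<alpha> i, \<beta> j) \<in> E" if "i < w" "j < w" for i j
        using X that by (auto simp: X_def)
      have V: "weave (\<alpha> k) (\<beta> k) l \<in> V" if "l < h" "k < w" for l k
        using E[OF that(2) that(2)] that(1)
        by (auto simp: E_def A_def B_def Ev_def Od_def weave_def PiE_def Pi_def)
      have r: "(weave (\<alpha> k) (\<beta> k) l, weave (\<alpha> k') (\<beta> k') (Suc l)) \<in> r"
        if "Suc l < h" "k < w" "k' < w" for l k k'
        using E[of k k'] E[of k' k] that by (cases "even l") (auto simp: E_def weave_def)
      show "?f p \<in> grid_walks r V h w"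
        using V r by (auto simp: p_eq grid_walks_def)
    qed
    show "finite (grid_walks r V h w)"
      by (rule finite_subset[of _ "{..<h} \<times> ?W \<rightarrow>\<^sub>E V"])
        (use assms in \<open>auto simp: grid_walks_def intro!: finite_PiE\<close>)
  qed
  finally show ?thesis
    by (simp add: divide_right_mono)
qed

section \<open>Embedding a poset into the blow-up of a chain\<close>

lemma card_chain_le_height:
  assumes "finite_poset P" "chain_in P C"
  shows "card C \<le> height P"
proof -
  have "finite {C. chain_in P C}"
    by (rule finite_subset[of _ "Pow (elements P)"])
      (use assms in \<open>auto simp: finite_poset_def chain_in_def\<close>)
  then show ?thesis
    using assms(2) by (auto simp: height_def)
qed

lemma card_antichain_le_width:
  assumes "finite_poset P" "antichain_in P A"
  shows "card A \<le> width P"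
proof -
  have "finite {A. antichain_in P A}"
    by (rule finite_subset[of _ "Pow (elements P)"])
      (use assms in \<open>auto simp: finite_poset_def antichain_in_def\<close>)
  then show ?thesis
    using assms(2) by (auto simp: width_def)
qed

lemma obtain_longest_chain:
  assumes "finite_poset P"
  obtains C where "chain_in P C" "card C = height P"
proof -
  have "finite {C. chain_in P C}"
    by (rule finite_subset[of _ "Pow (elements P)"])
      (use assms in \<open>auto simp: finite_poset_def chain_in_def\<close>)
  moreover have "chain_in P {}"
    by (simp add: chain_in_def)
  ultimately have "height P \<in> card ` {C. chain_in P C}"
    unfolding height_def by (intro Max_in) auto
  then show ?thesis
    using that by auto
qed

text \<open>The rank of an element is the size of a longest chain strictly below it.\<close>

lemma obtain_rank:
  assumes P: "finite_poset P"
  obtains \<rho> :: "'a \<Rightarrow> nat" where "\<And>x. x \<in> elements P \<Longrightarrow> \<rho> x < height P"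
    and "\<And>x y. (x, y) \<in> edges P \<Longrightarrow> \<rho> x < \<rho> y"
proof -
  define below where "below x = {C. chain_in P C \<and> (\<forall>c\<in>C. (c, x) \<in> edges P)}" for x
  define \<rho> where "\<rho> x = Max (card ` below x)" for x
  have tr: "trans (edges P)" and ir: "irrefl (edges P)" and fP: "finite (elements P)"
    and sub: "edges P \<subseteq> elements P \<times> elements P"
    using P by (auto simp: finite_poset_def)
  have fin: "finite (below x)" for x
    by (rule finite_subset[of _ "Pow (elements P)"])
      (use fP in \<open>auto simp: below_def chain_in_def\<close>)
  have "{} \<in> below x" for x
    by (simp add: below_def chain_in_def)
  then have "\<rho> x \<in> card ` below x" for x
    unfolding \<rho>_def using fin by (intro Max_in) auto
  then have ex: "\<exists>C\<in>below x. card C = \<rho> x" for x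
    by (metis imageE)
  have extend: "chain_in P (insert x C)" "card (insert x C) = Suc (card C)"
    if "C \<in> below x" "x \<in> elements P" for x C
  proof -
    show "chain_in P (insert x C)"
      using that by (auto simp: below_def chain_in_def total_on_def)
    have "x \<notin> C" "finite C"
      using that ir fP by (auto simp: below_def irrefl_def chain_in_def intro: finite_subset)
    then show "card (insert x C) = Suc (card C)"
      by simp
  qed
  show ?thesis
  proof
    show "\<rho> x < height P" if x: "x \<in> elements P" for x
      using ex[of x] extend[OF _ x] card_chain_le_height[OF P] by (metis Suc_le_eq)
    show "\<rho> x < \<rho> y" if xy: "(x, y) \<in> edges P" for x y
    proof -
      from ex[of x] obtain C where C: "C \<in> below x" "card C = \<rho> x"
        by auto
      have x: "x \<in> elements P"
        using xy sub by auto
      have "insert x C \<in> below y"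
        using extend(1)[OF C(1) x] C(1) xy tr by (auto simp: below_def dest: transD)
      then have "card (insert x C) \<le> \<rho> y"
        unfolding \<rho>_def using fin by (intro Max_ge) auto
      then show ?thesis
        using extend(2)[OF C(1) x] C(2) by simp
    qed
  qed
qed

text \<open>Elements of equal rank form an antichain, so that \<open>width P\<close> indices suffice for each rank.\<close>

lemma poset_embeds_in_grid:
  assumes P: "finite_poset P"
  obtains e where "inj_on e (elements P)"
    and "e ` elements P \<subseteq> {..<height P} \<times> {..<width P}"
    and "\<And>x y. (x, y) \<in> edges P \<Longrightarrow> fst (e x) < fst (e y)"
proof -
  obtain \<rho> :: "'a \<Rightarrow> nat" where \<rho>: "\<And>x. x \<in> elements P \<Longrightarrow> \<rho> x < height P"
    and mono: "\<And>x y. (x, y) \<in> edges P \<Longrightarrow> \<rho> x < \<rho> y"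
    using obtain_rank[OF P] by blast
  define layer where "layer i = {x \<in> elements P. \<rho> x = i}" for i
  have fin: "finite (layer i)" for i
    using P by (simp add: layer_def finite_poset_def)
  have "\<exists>f. inj_on f (layer i) \<and> f ` layer i \<subseteq> {..<width P}" for i
  proof -
    have "antichain_in P (layer i)"
      using mono by (fastforce simp: antichain_in_def layer_def)
    then have "card (layer i) \<le> card {..<width P}"
      using card_antichain_le_width[OF P] by simp
    then show ?thesis
      using card_le_inj[OF fin[of i] finite_lessThan] by blast
  qed
  then obtain index where index: "\<And>i. inj_on (index i) (layer i)"
      "\<And>i. index i ` layer i \<subseteq> {..<width P}"
    by metis
  show ?thesis
  proof
    let ?e = "\<lambda>x. (\<rho> x, index (\<rho> x) x)"
    show "inj_on ?e (elements P)"
      using index(1) by (auto simp: inj_on_def layer_def)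
    show "?e ` elements P \<subseteq> {..<height P} \<times> {..<width P}"
      using index(2) \<rho> by (force simp: layer_def)
    show "fst (?e x) < fst (?e y)" if "(x, y) \<in> edges P" for x y
      using mono[OF that] by simp
  qed
qed

lemma grid_walks_trans:
  assumes "trans r" "g \<in> grid_walks r V h w" "l < l'" "l' < h" "k < w" "k' < w"
  shows "(g (l, k), g (l', k')) \<in> r"
  using assms(3-6)
proof (induction l' arbitrary: k')
  case (Suc l')
  have step: "(g (l', k), g (Suc l', k')) \<in> r"
    using assms(2) Suc.prems by (auto simp: grid_walks_def)
  show ?case
  proof (cases "l = l'")
    case False
    then have "(g (l, k), g (l', k)) \<in> r"
      using Suc by simp
    then show ?thesis
      using step assms(1) by (auto dest: transD)
  qed (use step in simp)
qed simp

text \<open>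
  Restricting a uniformly random map on the grid to an embedded copy of \<open>Q\<close> gives a uniformly random
  map on \<open>Q\<close>, and it sends walks of the blow-up to homomorphisms.
\<close>

lemma grid_walks_density_le_hom_density:
  assumes Q: "finite_poset Q" and P: "finite_poset P" and ne: "elements P \<noteq> {}"
  shows "card (grid_walks (edges P) (elements P) (height Q) (width Q))
      / real (card (elements P)) ^ (height Q * width Q) \<le> hom_density Q P"
proof -
  obtain e where inj: "inj_on e (elements Q)"
    and range: "e ` elements Q \<subseteq> {..<height Q} \<times> {..<width Q}"
    and mono: "\<And>x y. (x, y) \<in> edges Q \<Longrightarrow> fst (e x) < fst (e y)"
    using poset_embeds_in_grid[OF Q] by blast
  let ?V = "elements P" and ?n = "card (elements P)"
  let ?grid = "{..<height Q} \<times> {..<width Q}"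
    and ?G = "grid_walks (edges P) (elements P) (height Q) (width Q)"
  define rest where "rest = ?grid - e ` elements Q"
  have fin: "finite ?V" "finite (elements Q)" and tr: "trans (edges P)"
    and subQ: "edges Q \<subseteq> elements Q \<times> elements Q"
    using P Q by (auto simp: finite_poset_def)
  have pos: "?n > 0"
    using fin ne by (simp add: card_gt_0_iff)
  have cardQ: "card (elements Q) + card rest = height Q * width Q"
    using range card_mono[OF _ range]
    by (simp add: rest_def card_Diff_subset finite_subset[OF range] card_image[OF inj])
  have finhoms: "finite (homs Q P)"
    by (rule finite_subset[of _ "elements Q \<rightarrow>\<^sub>E ?V"])
      (use fin in \<open>auto simp: homs_def intro!: finite_PiE\<close>)
  have "card ?G \<le> card (homs Q P \<times> (rest \<rightarrow>\<^sub>E ?V))"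
  proof (rule card_inj_on_le)
    let ?f = "\<lambda>g. (\<lambda>x\<in>elements Q. g (e x), restrict g rest)"
    show "inj_on ?f ?G"
    proof (rule inj_onI)
      fix g g' assume g: "g \<in> ?G" "g' \<in> ?G" and eq: "?f g = ?f g'"
      have "g p = g' p" if "p \<in> ?grid" for p
      proof (cases "p \<in> e ` elements Q")
        case True
        then obtain x where "x \<in> elements Q" "p = e x"
          by auto
        then show ?thesis
          using fun_cong[of _ _ x, OF conjunct1[OF eq[unfolded prod.inject]]] by simp
      next
        case False
        then show ?thesis
          using that fun_cong[of _ _ p, OF conjunct2[OF eq[unfolded prod.inject]]]
          by (simp add: rest_def)
      qed
      then show "g = g'"
        using g by (intro PiE_ext[of g ?grid "\<lambda>_. ?V"]) (auto simp: grid_walks_def)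
    qed
    show "?f ` ?G \<subseteq> homs Q P \<times> (rest \<rightarrow>\<^sub>E ?V)"
    proof (rule image_subsetI)
      fix g assume g: "g \<in> ?G"
      have V: "g p \<in> ?V" if "p \<in> ?grid" for p
        using g that by (auto simp: grid_walks_def)
      have "(g (e x), g (e y)) \<in> edges P" if xy: "(x, y) \<in> edges Q" for x y
      proof -
        have "e x \<in> ?grid" "e y \<in> ?grid"
          using xy subQ range by auto
        then show ?thesis
          using grid_walks_trans[OF tr g mono[OF xy], of "snd (e x)" "snd (e y)"]
          by (auto simp: mem_Times_iff)
      qed
      then show "?f g \<in> homs Q P \<times> (rest \<rightarrow>\<^sub>E ?V)"
        using V range subQ by (auto simp: homs_def rest_def)
    qed
    show "finite (homs Q P \<times> (rest \<rightarrow>\<^sub>E ?V))"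
      using finhoms fin by (simp add: finite_PiE rest_def)
  qed
  also have "\<dots> = card (homs Q P) * ?n ^ card rest"
    by (simp add: card_cartesian_product card_PiE rest_def)
  finally have "real (card ?G) / real ?n ^ (height Q * width Q)
      \<le> real (card (homs Q P) * ?n ^ card rest) / real ?n ^ (height Q * width Q)"
    by (intro divide_right_mono) (auto simp flip: of_nat_mult of_nat_power)
  also have "\<dots> = card (homs Q P) / real ?n ^ card (elements Q)"
    using pos by (simp add: power_add flip: cardQ)
  also have "\<dots> = hom_density Q P"
    using fin by (simp add: hom_density_def homs_def finite_PiE card_PiE
        measure_uniform_count_measure Collect_restrict)
  finally show ?thesis .
qed

section \<open>Elements with many elements below them\<close>

primrec rich :: "('a \<times> 'a) set \<Rightarrow> 'a set \<Rightarrow> real \<Rightarrow> nat \<Rightarrow> 'a set" where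
  "rich r V t 0 = V"
| "rich r V t (Suc i) = {x \<in> V. t \<le> card {y \<in> rich r V t i. (y, x) \<in> r}}"

lemma rich_subset: "rich r V t i \<subseteq> V"
  by (cases i) auto

lemma rich_upward_closed:
  assumes "trans r" "finite V" "(x, y) \<in> r" "y \<in> V" "x \<in> rich r V t i"
  shows "y \<in> rich r V t i"
proof (cases i)
  case (Suc j)
  have "card {z \<in> rich r V t j. (z, x) \<in> r} \<le> card {z \<in> rich r V t j. (z, y) \<in> r}"
    using assms finite_subset[OF rich_subset assms(2)]
    by (intro card_mono) (auto dest: transD)
  then show ?thesis
    using assms Suc by simp
qed (use assms in simp)

text \<open>From an element of \<open>rich r V t i\<close>, each of \<open>i\<close> downward steps offers at least \<open>t\<close> choices.\<close>

lemma card_walks_to_rich_ge: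
  assumes "finite V" "0 \<le> t" "x \<in> rich r V t i"
  shows "t ^ i \<le> card {c \<in> walks r V (Suc i). c i = x}"
  using assms(3)
proof (induction i arbitrary: x)
  case 0
  have "(\<lambda>l\<in>{..<Suc 0}. x) \<in> {c \<in> walks r V (Suc 0). c 0 = x}"
    using 0 by (auto simp: walks_def)
  then have "card {c \<in> walks r V (Suc 0). c 0 = x} > 0"
    by (subst card_gt_0_iff) (auto simp: finite_walks[OF assms(1)])
  then show ?case
    by simp
next
  case (Suc i)
  let ?D = "{y \<in> rich r V t i. (y, x) \<in> r}"
  let ?C = "\<lambda>y. {c \<in> walks r V (Suc i). c i = y}"
  have finD: "finite ?D"
    using finite_subset[OF rich_subset assms(1)] by auto
  have x: "x \<in> V" "t \<le> card ?D"
    using Suc.prems by auto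
  have "t ^ Suc i \<le> card ?D * t ^ i"
    using x assms(2) by (simp add: mult_right_mono)
  also have "\<dots> = (\<Sum>y\<in>?D. t ^ i)"
    by simp
  also have "\<dots> \<le> (\<Sum>y\<in>?D. real (card (?C y)))"
    using Suc.IH by (intro sum_mono) auto
  also have "\<dots> = card (SIGMA y:?D. ?C y)"
    using finD finite_walks[OF assms(1)] by simp
  also have "card (SIGMA y:?D. ?C y) \<le> card {c \<in> walks r V (Suc (Suc i)). c (Suc i) = x}"
  proof (rule card_inj_on_le)
    let ?f = "\<lambda>(y, c). c(Suc i := x)"
    show "inj_on ?f (SIGMA y:?D. ?C y)"
    proof (rule inj_onI, clarify)
      fix c d
      assume c: "c \<in> walks r V (Suc i)" and d: "d \<in> walks r V (Suc i)"
        and eq: "c(Suc i := x) = d(Suc i := x)"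
      have "c l = d l" if "l < Suc i" for l
        using fun_cong[OF eq, of l] that by (simp split: if_splits)
      then have "c = d"
        using c d by (intro PiE_ext[of c "{..<Suc i}" "\<lambda>_. V"]) (auto simp: walks_def)
      then show "c i = d i \<and> c = d"
        by simp
    qed
    show "?f ` (SIGMA y:?D. ?C y) \<subseteq> {c \<in> walks r V (Suc (Suc i)). c (Suc i) = x}"
    proof (rule image_subsetI)
      fix p assume p: "p \<in> (SIGMA y:?D. ?C y)"
      define c where "c = snd p"
      have c: "c \<in> walks r V (Suc i)" and ci: "(c i, x) \<in> r" and fp: "?f p = c(Suc i := x)"
        using p by (auto simp: c_def)
      have "c(Suc i := x) \<in> {..<Suc (Suc i)} \<rightarrow>\<^sub>E V"
        using c x by (auto simp: walks_def PiE_def Pi_def extensional_def)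
      moreover have "((c(Suc i := x)) l, (c(Suc i := x)) (Suc l)) \<in> r" if "Suc l < Suc (Suc i)" for l
        using c ci that by (cases "l = i") (auto simp: walks_def)
      ultimately show "?f p \<in> {c \<in> walks r V (Suc (Suc i)). c (Suc i) = x}"
        by (simp add: fp walks_def)
    qed
  qed (use finite_walks[OF assms(1)] in simp)
  finally show ?case
    by simp
qed

lemma card_walks_ge:
  assumes "finite V" "0 \<le> t" "t \<le> card (rich r V t i)"
  shows "t ^ Suc i \<le> card (walks r V (Suc i))"
proof -
  let ?L = "rich r V t i" and ?C = "\<lambda>x. {c \<in> walks r V (Suc i). c i = x}"
  have finL: "finite ?L"
    using finite_subset[OF rich_subset assms(1)] .
  have "t ^ Suc i \<le> card ?L * t ^ i"
    using assms by (simp add: mult_right_mono)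
  also have "\<dots> \<le> (\<Sum>x\<in>?L. real (card (?C x)))"
    using sum_mono[OF card_walks_to_rich_ge[OF assms(1,2), where r = r and i = i], of ?L] by simp
  also have "\<dots> = card (\<Union>x\<in>?L. ?C x)"
    using finL finite_walks[OF assms(1)] by (subst card_UN_disjoint) auto
  also have "card (\<Union>x\<in>?L. ?C x) \<le> card (walks r V (Suc i))"
    using finite_walks[OF assms(1)] by (intro card_mono) auto
  finally show ?thesis
    by simp
qed

text \<open>
  Walking down from the top set produces walks of density at least \<open>\<delta>\<close> to the power \<open>height Q\<close>; passing
  to the blow-up raises this bound to the power \<open>(width Q)\<^sup>2\<close>.
\<close>

lemma dense_top_imp_hom_density_ge:
  fixes \<delta> :: real
  assumes Q: "finite_poset Q" and P: "finite_poset P" and \<delta>: "0 \<le> \<delta>"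
    and top: "\<delta> * card (elements P)
      < card (rich (edges P) (elements P) (\<delta> * card (elements P)) (height Q - 1))"
    and h: "height Q > 0"
  shows "\<delta> ^ (height Q * (width Q)\<^sup>2) \<le> hom_density Q P"
proof -
  let ?V = "elements P" and ?n = "card (elements P)"
  let ?h = "height Q" and ?w = "width Q"
  have fin: "finite ?V"
    using P by (simp add: finite_poset_def)
  have ne: "?V \<noteq> {}"
  proof
    assume "?V = {}"
    then show False
      using top rich_subset[of "edges P" ?V "\<delta> * ?n" "?h - 1"] by simp
  qed
  then have pos: "real ?n > 0"
    using fin by (simp add: card_gt_0_iff)
  have "(\<delta> * ?n) ^ ?h \<le> card (walks (edges P) ?V ?h)"
    using card_walks_ge[OF fin, of "\<delta> * ?n" "edges P" "?h - 1"] top \<delta> h by simp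
  then have "\<delta> ^ ?h \<le> card (walks (edges P) ?V ?h) / real ?n ^ ?h"
    using pos by (simp add: pos_le_divide_eq power_mult_distrib)
  then have "(\<delta> ^ ?h) ^ (?w * ?w) \<le> (card (walks (edges P) ?V ?h) / real ?n ^ ?h) ^ (?w * ?w)"
    using \<delta> by (intro power_mono) auto
  also have "\<dots> \<le> hom_density Q P"
    using grid_walks_density[OF fin ne] grid_walks_density_le_hom_density[OF Q P ne]
    by (rule order_trans)
  finally show ?thesis
    by (simp add: power2_eq_square flip: power_mult)
qed

section \<open>Removing edges when few elements are rich\<close>

text \<open>
  A function that increases along edges and takes fewer than \<open>card C\<close> values at their ends is not
  compatible with a homomorphic image of the chain \<open>C\<close>.
\<close>

lemma poset_free_if_levels:
  assumes "\<And>x y. (x, y) \<in> edges R \<Longrightarrow> v x < v y \<and> v y < m"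
    and C: "chain_in Q C" "m < card C" "2 \<le> card C"
  shows "poset_free Q R"
  unfolding poset_free_def
proof (intro notI, elim bexE)
  fix f assume f: "f \<in> homs Q R"
  have lev: "v (f x) \<noteq> v (f y) \<and> v (f x) < m" if "x \<in> C" "y \<in> C" "x \<noteq> y" for x y
  proof -
    have "(x, y) \<in> edges Q \<or> (y, x) \<in> edges Q"
      using that C(1) by (auto simp: chain_in_def total_on_def)
    then have "(f x, f y) \<in> edges R \<or> (f y, f x) \<in> edges R"
      using f by (auto simp: homs_def)
    then show ?thesis
      using assms(1) by (metis less_irrefl less_trans)
  qed
  have "v (f x) < m" if "x \<in> C" for x
  proof -
    have "C - {x} \<noteq> {}"
      using C(3) card_mono[of "{x}" C] by fastforce
    then show ?thesis
      using lev[OF that] by auto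
  qed
  then have "card C \<le> card {..<m}"
    using lev by (intro card_inj_on_le[of "v \<circ> f"]) (auto simp: inj_on_def)
  then show False
    using C(2) by simp
qed

text \<open>
  Keeping exactly the edges that increase the level and do not end in the top set preserves
  transitivity.  Each element outside the top set loses at most \<open>\<delta> n\<close> incoming edges, where \<open>n\<close> is the
  number of elements of \<open>P\<close>; the elements of the top set lose up to \<open>n\<close> each, but there are at most
  \<open>\<delta> n\<close> of them.
\<close>

lemma sparse_top_imp_removal:
  fixes P :: "'a poset" and \<delta> :: real
  assumes P: "finite_poset P" and \<delta>: "0 \<le> \<delta>" and h: "2 \<le> h"
    and top: "card (rich (edges P) (elements P) (\<delta> * card (elements P)) (h - 1))
      \<le> \<delta> * card (elements P)"
  obtains R and v :: "'a \<Rightarrow> nat" where "edge_removal_subposet R P"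
    and "real (card (edges P - edges R)) \<le> 2 * \<delta> * (real (card (elements P)))\<^sup>2"
    and "\<And>x y. (x, y) \<in> edges R \<Longrightarrow> v x < v y \<and> v y < h - 1"
proof -
  let ?V = "elements P" and ?r = "edges P" and ?n = "card (elements P)"
  define L where "L = rich ?r ?V (\<delta> * ?n)"
  define I where "I x = {i. 0 < i \<and> i < h \<and> x \<in> L i}" for x
  define R where "R = \<lparr>elements = ?V,
    edges = {(x, y) \<in> ?r. card (I x) < card (I y) \<and> y \<notin> L (h - 1)}\<rparr>"
  have fin: "finite ?V" and tr: "trans ?r" and ir: "irrefl ?r" and sub: "?r \<subseteq> ?V \<times> ?V"
    using P by (auto simp: finite_poset_def)
  have finI: "finite (I x)" for x
    by (simp add: I_def)
  have finL: "finite (L i)" for i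
    unfolding L_def by (rule finite_subset[OF rich_subset fin])
  have I_mono: "I x \<subseteq> I y" if "(x, y) \<in> ?r" for x y
    using that sub rich_upward_closed[OF tr fin that] by (auto simp: I_def L_def)
  have "trans (edges R)"
    using tr by (auto simp: R_def intro!: transI dest: transD)
  then have sp: "edge_removal_subposet R P"
    using fin ir sub by (auto simp: edge_removal_subposet_def finite_poset_def R_def irrefl_def)
  have low: "card (I y) < h - 1" if "y \<notin> L (h - 1)" for y
  proof -
    have "I y \<subseteq> {1..h - 1}" "h - 1 \<notin> I y" "h - 1 \<in> {1..h - 1}"
      using that h by (auto simp: I_def)
    then have "I y \<subset> {1..h - 1}"
      by blast
    then show ?thesis
      using psubset_card_mono[of "{1..h - 1}" "I y"] by simp
  qed
  have lev: "card (I x) < card (I y) \<and> card (I y) < h - 1" if "(x, y) \<in> edges R" for x y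
    using that low by (auto simp: R_def)
  \<comment> \<open>An edge between equal levels into \<open>y\<close> starts in the last set \<open>L j\<close> before the first one that
    misses \<open>y\<close>, and only few elements of that set lie below \<open>y\<close>.\<close>
  have flat: "card {x. (x, y) \<in> ?r \<and> I x = I y} \<le> \<delta> * ?n" if y: "y \<in> ?V" "y \<notin> L (h - 1)" for y
  proof -
    define i where "i = (LEAST i. y \<notin> L i)"
    have i: "y \<notin> L i" "i \<le> h - 1"
      using y(2) unfolding i_def
      by (rule LeastI[of "\<lambda>i. y \<notin> L i"], rule Least_le[of "\<lambda>i. y \<notin> L i"])
    with y(1) have "i \<noteq> 0"
      by (metis L_def rich.simps(1))
    then obtain j where j: "i = Suc j"
      using not0_implies_Suc by blast
    then have yj: "y \<in> L j"
      using not_less_Least[of j "\<lambda>i. y \<notin> L i"] by (auto simp: i_def)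
    have "x \<in> L j" if x: "(x, y) \<in> ?r" "I x = I y" for x
    proof (cases "j = 0")
      case True
      then show ?thesis
        using x(1) sub by (auto simp: L_def)
    next
      case False
      then have "j \<in> I y"
        using yj i(2) j h by (auto simp: I_def)
      then show ?thesis
        using x(2) by (auto simp: I_def)
    qed
    then have "card {x. (x, y) \<in> ?r \<and> I x = I y} \<le> card {x \<in> L j. (x, y) \<in> ?r}"
      using finL by (intro card_mono) auto
    moreover have "card {x \<in> L j. (x, y) \<in> ?r} < \<delta> * ?n"
      using i(1) y(1) by (simp add: j L_def)
    ultimately show ?thesis
      by linarith
  qed
  let ?F = "SIGMA y:?V - L (h - 1). {x. (x, y) \<in> ?r \<and> I x = I y}"
  have fin_below: "finite {x. (x, y) \<in> ?r \<and> I x = I y}" for y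
    by (rule finite_subset[OF _ fin]) (use sub in auto)
  have finF: "finite ?F"
    using fin fin_below by auto
  have "?r - edges R \<subseteq> ?V \<times> L (h - 1) \<union> (\<lambda>(y, x). (x, y)) ` ?F"
  proof clarify
    fix x y assume xy: "(x, y) \<in> ?r" "(x, y) \<notin> edges R"
      and nF: "(x, y) \<notin> (\<lambda>(y, x). (x, y)) ` ?F"
    have "I x = I y" if "y \<notin> L (h - 1)"
      using xy that psubset_card_mono[OF finI[of y], of "I x"] I_mono[OF xy(1)] by (auto simp: R_def)
    then show "x \<in> ?V \<and> y \<in> L (h - 1)"
      using xy sub nF by force
  qed
  then have "card (?r - edges R) \<le> card (?V \<times> L (h - 1) \<union> (\<lambda>(y, x). (x, y)) ` ?F)"
    using fin finL finF by (intro card_mono) auto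
  also have "\<dots> \<le> card (?V \<times> L (h - 1)) + card ((\<lambda>(y, x). (x, y)) ` ?F)"
    by (rule card_Un_le)
  also have "\<dots> \<le> card (?V \<times> L (h - 1)) + card ?F"
    using card_image_le[OF finF] by simp
  finally have "real (card (?r - edges R))
      \<le> real ?n * real (card (L (h - 1))) + real (card ?F)"
    by (simp add: card_cartesian_product flip: of_nat_add of_nat_mult)
  also have "real (card ?F) \<le> ?n * (\<delta> * ?n)"
  proof -
    have "real (card ?F) = (\<Sum>y\<in>?V - L (h - 1). real (card {x. (x, y) \<in> ?r \<and> I x = I y}))"
      using fin fin_below by simp
    also have "\<dots> \<le> (\<Sum>y\<in>?V - L (h - 1). \<delta> * ?n)"
      using flat by (intro sum_mono) auto
    also have "\<dots> \<le> (\<Sum>y\<in>?V. \<delta> * ?n)"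
      using fin \<delta> by (intro sum_mono2) auto
    finally show ?thesis
      by simp
  qed
  also have "real ?n * real (card (L (h - 1))) \<le> ?n * (\<delta> * ?n)"
    using top by (simp add: L_def mult_left_mono)
  finally have "real (card (?r - edges R)) \<le> 2 * \<delta> * (real ?n)\<^sup>2"
    by (simp add: power2_eq_square algebra_simps)
  then show ?thesis
    by (rule that[OF sp _ lev])
qed

section \<open>The removal lemma\<close>

theorem corollary1p2:
  fixes \<P> :: "'a poset set" and Q :: "'a poset" and P :: "'b poset" and \<epsilon> :: real
  assumes "\<And>Q'. Q' \<in> \<P> \<Longrightarrow> finite_poset Q'"
    and "family_height \<P> \<ge> 2"
    and "Q \<in> \<P>"
    and "height Q = family_height \<P>"
    and "width Q = family_width \<P>"
    and "\<epsilon> > 0"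
    and "finite_poset P"
    and "hom_density Q P < (\<epsilon> / 2) ^ (family_height \<P> * (family_width \<P>)\<^sup>2)"
  shows "\<exists>R. edge_removal_subposet R P \<and>
             real (card (edges P - edges R)) \<le> \<epsilon> * (real (card (elements P)))\<^sup>2 \<and>
             family_free \<P> R \<and> poset_free (chain_poset (family_height \<P>)) R"
proof -
  let ?h = "family_height \<P>"
  have "\<not> \<epsilon> / 2 * card (elements P)
      < card (rich (edges P) (elements P) (\<epsilon> / 2 * card (elements P)) (?h - 1))"
  proof
    assume *: "\<epsilon> / 2 * card (elements P)
      < card (rich (edges P) (elements P) (\<epsilon> / 2 * card (elements P)) (?h - 1))"
    have "(\<epsilon> / 2) ^ (height Q * (width Q)\<^sup>2) \<le> hom_density Q P"
      by (rule dense_top_imp_hom_density_ge) (use * assms in auto)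
    then show False
      using assms by simp
  qed
  then have top: "card (rich (edges P) (elements P) (\<epsilon> / 2 * card (elements P)) (?h - 1))
      \<le> \<epsilon> / 2 * card (elements P)"
    by simp
  have "0 \<le> \<epsilon> / 2"
    using assms by simp
  from sparse_top_imp_removal[OF assms(7) this assms(2) top]
  obtain R and v :: "'b \<Rightarrow> nat" where R: "edge_removal_subposet R P"
      "real (card (edges P - edges R)) \<le> 2 * (\<epsilon> / 2) * (real (card (elements P)))\<^sup>2"
    and v: "\<And>x y. (x, y) \<in> edges R \<Longrightarrow> v x < v y \<and> v y < ?h - 1"
    by blast
  have "family_free \<P> R"
    unfolding family_free_def
  proof
    fix Q' assume Q': "Q' \<in> \<P>"
    obtain C where "chain_in Q' C" "card C = height Q'"
      using obtain_longest_chain assms(1)[OF Q'] by blast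
    moreover have "?h \<le> height Q'"
      unfolding family_height_def using Q' by (intro cInf_lower) auto
    ultimately show "poset_free Q' R"
      using assms(2) by (intro poset_free_if_levels[of R v, OF v]) auto
  qed
  moreover have "poset_free (chain_poset ?h) R"
    by (rule poset_free_if_levels[of R v, OF v, where C = "{..<?h}"])
      (use assms(2) in \<open>auto simp: chain_poset_def chain_in_def total_on_def\<close>)
  ultimately show ?thesis
    using R by auto
qed

end
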